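(* Let $G=(V,E)$ be a finite graph, $\beta>0$, $\pmb{J}=(J_{ij})\in[0,\infty)^E$, $p_{ij}=1-\exp(-2\beta J_{ij})$ for $\{i,j\}\in E$, and let $\pmb{h}=(h_i:i\in V)\in\mathbb{R}^V$ be an external field. Then: (1) for every $\sigma\in\{-1,+1\}^V$, $\displaystyle\sum_{\omega\in\{0,1\}^E}\nu_{\pmb{p},\pmb{h},G}(\sigma,\omega)=\lambda_{\beta,\pmb{h},V}(\sigma)$; (2) for every $\omega\in\{0,1\}^E$, $\displaystyle\sum_{\sigma\in\{-1,+1\}^V}\nu_{\pmb{p},\pmb{h},G}(\sigma,\omega)=\phi_{\pmb{p},\pmb{h},G}(\omega)$.
   Context: Ising measure with free boundary condition: $\lambda_{\beta,\pmb{h},V}(\sigma)\propto\exp\big(\beta\sum_{\{i,j\}\in E}J_{ij}\sigma_i\sigma_j+\beta\sum_{i\in V}h_i\sigma_i\big)$ on $\{-1,+1\}^V$, normalized to be a probability. For $\omega\in\{0,1\}^E$, an edge $e$ is open if $\omega_e=1$; $\eta(\omega)$ is the set of open edges; $K_1,\dots,K_{k(\omega,G)}$ are the (vertex sets of the) connected components of $(V,\eta(\omega))$; $\pmb{h}(K)=\beta\sum_{i\in K}h_i$; and $B_{\pmb{J}}(\omega)=\prod_{\{i,j\}:\omega_{ij}=1}p_{ij}\prod_{\{i,j\}:\omega_{ij}=0}(1-p_{ij})$. Random-cluster measure: $\phi_{\pmb{p},\pmb{h},G}(\omega)\propto B_{\pmb{J}}(\omega)\prod_{\alpha=1}^{k(\omega,G)}2\cosh(\pmb{h}(K_\alpha))$,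 normalized to be a probability on $\{0,1\}^E$. Edwards-Sokal measure: $\nu_{\pmb{p},\pmb{h},G}(\sigma,\omega)\propto B_{\pmb{J}}(\omega)\,\Delta(\sigma,\omega)\exp\big(\beta\sum_{i\in V}h_i(\delta_{\sigma_i,1}-\delta_{\sigma_i,-1})\big)$, normalized to be a probability on $\{-1,+1\}^V\times\{0,1\}^E$, where $\Delta(\sigma,\omega)=1$ if $\sigma_i=\sigma_j$ for every $\{i,j\}\in E$ with $\omega_{ij}=1$, and $\Delta(\sigma,\omega)=0$ otherwise. *)

theory Defs
  imports Complex_Main "HOL-Library.FuncSet"
begin

definition finite_graph :: "'a set \<Rightarrow> 'a set set \<Rightarrow> bool" where
  "finite_graph V E \<longleftrightarrow>
     finite V \<and> (\<forall>e\<in>E. \<exists>i\<in>V. \<exists>j\<in>V. i \<noteq> j \<and> e = {i, j})"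

text \<open>Configurations are extensional functions, so that each configuration is represented
  exactly once and sums over the two spaces below are sums over configurations.\<close>

definition spins :: "'a set \<Rightarrow> ('a \<Rightarrow> real) set" where
  "spins V = (V \<rightarrow>\<^sub>E {-1, 1})"

definition edge_configs :: "'a set set \<Rightarrow> ('a set \<Rightarrow> nat) set" where
  "edge_configs E = (E \<rightarrow>\<^sub>E {0, 1})"

text \<open>The probability mass function on the finite set \<open>S\<close> proportional to the weight \<open>w\<close>.\<close>

definition normalized :: "'c set \<Rightarrow> ('c \<Rightarrow> real) \<Rightarrow> 'c \<Rightarrow> real" where
  "normalized S w x = w x / (\<Sum>y\<in>S. w y)"

text \<open>For an edge \<open>e = {i, j}\<close>, the product \<open>\<Prod>i\<in>e. \<sigma> i\<close> is \<open>\<sigma> i * \<sigma> j\<close>.\<close>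

definition ising_weight ::
  "real \<Rightarrow> ('a set \<Rightarrow> real) \<Rightarrow> ('a \<Rightarrow> real) \<Rightarrow> 'a set \<Rightarrow> 'a set set \<Rightarrow> ('a \<Rightarrow> real) \<Rightarrow> real" where
  "ising_weight \<beta> J h V E \<sigma> =
     exp (\<beta> * (\<Sum>e\<in>E. J e * (\<Prod>i\<in>e. \<sigma> i)) + \<beta> * (\<Sum>i\<in>V. h i * \<sigma> i))"

definition ising ::
  "real \<Rightarrow> ('a set \<Rightarrow> real) \<Rightarrow> ('a \<Rightarrow> real) \<Rightarrow> 'a set \<Rightarrow> 'a set set \<Rightarrow> ('a \<Rightarrow> real) \<Rightarrow> real" where
  "ising \<beta> J h V E = normalized (spins V) (ising_weight \<beta> J h V E)"

definition open_edges :: "'a set set \<Rightarrow> ('a set \<Rightarrow> nat) \<Rightarrow> 'a set set" where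
  "open_edges E \<omega> = {e \<in> E. \<omega> e = 1}"

text \<open>Vertex sets of the connected components of the graph \<open>(V, F)\<close>: the classes of \<open>V\<close> under
  the relation of being joined by a path. Isolated vertices form components of their own.\<close>

definition clusters :: "'a set \<Rightarrow> 'a set set \<Rightarrow> 'a set set" where
  "clusters V F = V // {(i, j). i \<in> V \<and> j \<in> V \<and> (i, j) \<in> {(u, v). {u, v} \<in> F}\<^sup>*}"

definition bernoulli_weight ::
  "('a set \<Rightarrow> real) \<Rightarrow> 'a set set \<Rightarrow> ('a set \<Rightarrow> nat) \<Rightarrow> real" where
  "bernoulli_weight p E \<omega> =
     (\<Prod>e\<in>{e\<in>E. \<omega> e = 1}. p e) * (\<Prod>e\<in>{e\<in>E. \<omega> e = 0}. 1 - p e)"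

definition rc_weight ::
  "real \<Rightarrow> ('a set \<Rightarrow> real) \<Rightarrow> ('a \<Rightarrow> real) \<Rightarrow> 'a set \<Rightarrow> 'a set set \<Rightarrow> ('a set \<Rightarrow> nat) \<Rightarrow> real" where
  "rc_weight \<beta> p h V E \<omega> =
     bernoulli_weight p E \<omega> *
     (\<Prod>K\<in>clusters V (open_edges E \<omega>). 2 * cosh (\<beta> * (\<Sum>i\<in>K. h i)))"

definition random_cluster ::
  "real \<Rightarrow> ('a set \<Rightarrow> real) \<Rightarrow> ('a \<Rightarrow> real) \<Rightarrow> 'a set \<Rightarrow> 'a set set \<Rightarrow> ('a set \<Rightarrow> nat) \<Rightarrow> real" where
  "random_cluster \<beta> p h V E = normalized (edge_configs E) (rc_weight \<beta> p h V E)"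

definition es_indicator :: "'a set set \<Rightarrow> ('a \<Rightarrow> real) \<Rightarrow> ('a set \<Rightarrow> nat) \<Rightarrow> real" where
  "es_indicator E \<sigma> \<omega> = (if \<forall>i j. {i, j} \<in> E \<and> \<omega> {i, j} = 1 \<longrightarrow> \<sigma> i = \<sigma> j then 1 else 0)"

definition es_weight ::
  "real \<Rightarrow> ('a set \<Rightarrow> real) \<Rightarrow> ('a \<Rightarrow> real) \<Rightarrow> 'a set \<Rightarrow> 'a set set \<Rightarrow>
     ('a \<Rightarrow> real) \<times> ('a set \<Rightarrow> nat) \<Rightarrow> real" where
  "es_weight \<beta> p h V E = (\<lambda>(\<sigma>, \<omega>).
     bernoulli_weight p E \<omega> * es_indicator E \<sigma> \<omega> *
     exp (\<beta> * (\<Sum>i\<in>V. h i * (of_bool (\<sigma> i = 1) - of_bool (\<sigma> i = -1)))))"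

definition edwards_sokal ::
  "real \<Rightarrow> ('a set \<Rightarrow> real) \<Rightarrow> ('a \<Rightarrow> real) \<Rightarrow> 'a set \<Rightarrow> 'a set set \<Rightarrow>
     ('a \<Rightarrow> real) \<times> ('a set \<Rightarrow> nat) \<Rightarrow> real" where
  "edwards_sokal \<beta> p h V E = normalized (spins V \<times> edge_configs E) (es_weight \<beta> p h V E)"

text \<open>The three normalizing constants are positive, so the divisions are genuine
  normalizations.\<close>

lemma finite_spins: "finite_graph V E \<Longrightarrow> finite (spins V)"
  by (simp add: finite_graph_def spins_def finite_PiE)

lemma finite_edges: "finite_graph V E \<Longrightarrow> finite E"
  by (rule finite_subset[of _ "Pow V"]) (auto simp: finite_graph_def)

lemma finite_edge_configs: "finite_graph V E \<Longrightarrow> finite (edge_configs E)"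
  by (simp add: edge_configs_def finite_PiE finite_edges)

lemma bernoulli_weight_nonneg:
  assumes "\<And>e. e \<in> E \<Longrightarrow> 0 \<le> p e \<and> p e < 1"
  shows "0 \<le> bernoulli_weight p E \<omega>"
  unfolding bernoulli_weight_def
  by (intro mult_nonneg_nonneg prod_nonneg) (use assms in \<open>auto simp: less_imp_le\<close>)

lemma bernoulli_weight_closed_pos:
  assumes "\<And>e. e \<in> E \<Longrightarrow> 0 \<le> p e \<and> p e < 1"
  shows "0 < bernoulli_weight p E (\<lambda>e\<in>E. 0)"
proof -
  have eqs: "{e \<in> E. (\<lambda>e\<in>E. 0::nat) e = 1} = {}" "{e \<in> E. (\<lambda>e\<in>E. 0::nat) e = 0} = E"
    by auto
  show ?thesis
    unfolding bernoulli_weight_def eqs using assms by (auto intro!: prod_pos)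
qed

lemma ising_partition_pos:
  assumes "finite_graph V E"
  shows "0 < (\<Sum>\<sigma>\<in>spins V. ising_weight \<beta> J h V E \<sigma>)"
proof (rule sum_pos)
  show "finite (spins V)" using assms by (rule finite_spins)
  show "spins V \<noteq> {}" by (simp add: spins_def PiE_eq_empty_iff)
qed (simp add: ising_weight_def)

lemma random_cluster_partition_pos:
  assumes "finite_graph V E" "\<And>e. e \<in> E \<Longrightarrow> 0 \<le> p e \<and> p e < 1"
  shows "0 < (\<Sum>\<omega>\<in>edge_configs E. rc_weight \<beta> p h V E \<omega>)"
proof (rule sum_pos2[of _ "\<lambda>e\<in>E. 0"])
  show "0 < rc_weight \<beta> p h V E (\<lambda>e\<in>E. 0)"
    unfolding rc_weight_def
    by (intro mult_pos_pos bernoulli_weight_closed_pos assms prod_pos) (auto simp: cosh_real_pos)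
  show "0 \<le> rc_weight \<beta> p h V E \<omega>" for \<omega>
    unfolding rc_weight_def
    by (intro mult_nonneg_nonneg bernoulli_weight_nonneg assms prod_nonneg) auto
  show "finite (edge_configs E)"
    using assms(1) by (rule finite_edge_configs)
qed (auto simp: edge_configs_def)

lemma edwards_sokal_partition_pos:
  assumes "finite_graph V E" "\<And>e. e \<in> E \<Longrightarrow> 0 \<le> p e \<and> p e < 1"
  shows "0 < (\<Sum>x\<in>spins V \<times> edge_configs E. es_weight \<beta> p h V E x)"
proof (rule sum_pos2[of _ "(\<lambda>i\<in>V. 1, \<lambda>e\<in>E. 0)"])
  have "es_indicator E (\<lambda>i\<in>V. 1) (\<lambda>e\<in>E. 0) = 1"
    by (simp add: es_indicator_def)
  then show "0 < es_weight \<beta> p h V E (\<lambda>i\<in>V. 1, \<lambda>e\<in>E. 0)"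
    using bernoulli_weight_closed_pos[of E p] assms(2) by (simp add: es_weight_def)
  show "0 \<le> es_weight \<beta> p h V E x" for x
    using bernoulli_weight_nonneg[of E p] assms(2)
    by (auto simp: es_weight_def es_indicator_def split: prod.split)
  show "finite (spins V \<times> edge_configs E)"
    using assms(1) by (simp add: finite_spins finite_edge_configs)
qed (auto simp: edge_configs_def spins_def)

end

theory Submission
  imports Defs
begin

text \<open>The Edwards--Sokal weight is a product over edges once the spins are fixed, and a product
  over open clusters once the edge configuration is fixed, in each case up to a factor that is
  fixed too: the field weight of the spins, or the percolation weight of the edges. Each marginal
  is therefore that factor times a product of two-term sums.

  Fix the spins \<open>\<sigma>\<close>. An edge whose endpoints agree contributes \<open>p e + (1 - p e) = 1\<close>, and an
  edge whose endpoints disagree must be closed and contributes \<open>1 - p e = exp (- 2 * \<beta> * J e)\<close>.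
  Both values equal \<open>exp (\<beta> * J e * (\<sigma> i * \<sigma> j - 1))\<close>, so the marginal weight is the Ising
  weight times the constant \<open>exp (- \<beta> * (\<Sum>e\<in>E. J e))\<close>
  (lemma \<open>sum_es_weight_edge_configs\<close>).

  Fix the edges \<open>\<omega>\<close>. The compatible spin configurations are exactly those that are constant on
  every open cluster, that is, they choose one sign freely for each cluster \<open>K\<close>. Its two signs
  contribute \<open>exp (\<beta> * h(K)) + exp (- \<beta> * h(K)) = 2 * cosh (\<beta> * h(K))\<close>, with \<open>h(K)\<close> the total
  field on \<open>K\<close>, so the marginal weight is the random-cluster weight
  (lemma \<open>sum_es_weight_spins\<close>).

  A constant factor between weights disappears under normalization
  (lemma \<open>sum_normalized_snd\<close>), which turns these two identities between weights into identities
  between probability measures.\<close>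

section \<open>Marginals of normalized weights\<close>

text \<open>Summing \<open>marg\<close> over \<open>A\<close> shows that the two partition functions differ by the same factor \<open>c\<close>
  as the weights do.\<close>

lemma sum_normalized_snd:
  assumes c: "c \<noteq> 0" and x: "x \<in> A"
    and marg: "\<And>a. a \<in> A \<Longrightarrow> (\<Sum>b\<in>B. w (a, b)) = c * v a"
  shows "(\<Sum>b\<in>B. normalized (A \<times> B) w (x, b)) = normalized A v x"
proof -
  have "(\<Sum>z\<in>A \<times> B. w z) = (\<Sum>a\<in>A. c * v a)"
    by (simp add: sum.cartesian_product' marg)
  also have "\<dots> = c * (\<Sum>a\<in>A. v a)"
    by (simp add: sum_distrib_left)
  finally show ?thesis
    using c by (simp add: normalized_def marg[OF x] flip: sum_divide_distrib)
qed

lemma normalized_swap: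
  "normalized (A \<times> B) w (a, b) = normalized (B \<times> A) (\<lambda>(b, a). w (a, b)) (b, a)"
  unfolding normalized_def
  by (simp add: sum.cartesian_product' sum.swap[of _ B A])

section \<open>The spin marginal\<close>

definition monochromatic :: "('a \<Rightarrow> real) \<Rightarrow> 'a set \<Rightarrow> bool" where
  "monochromatic \<sigma> e \<longleftrightarrow> (\<forall>i\<in>e. \<forall>j\<in>e. \<sigma> i = \<sigma> j)"

lemma spin_cases: "\<sigma> \<in> spins V \<Longrightarrow> i \<in> V \<Longrightarrow> \<sigma> i = -1 \<or> \<sigma> i = 1"
  by (auto simp: spins_def)

lemma es_field:
  assumes "\<sigma> \<in> spins V"
  shows "(\<Sum>i\<in>V. h i * (of_bool (\<sigma> i = 1) - of_bool (\<sigma> i = -1))) = (\<Sum>i\<in>V. h i * \<sigma> i)"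
  using spin_cases[OF assms] by (intro sum.cong) auto

lemma es_indicator_eq:
  assumes "finite_graph V E"
  shows "es_indicator E \<sigma> \<omega> = of_bool (\<forall>e\<in>E. \<omega> e = 1 \<longrightarrow> monochromatic \<sigma> e)"
proof -
  have "(\<forall>i j. {i, j} \<in> E \<and> \<omega> {i, j} = 1 \<longrightarrow> \<sigma> i = \<sigma> j) \<longleftrightarrow>
        (\<forall>e\<in>E. \<omega> e = 1 \<longrightarrow> monochromatic \<sigma> e)" (is "?L \<longleftrightarrow> ?R")
  proof
    assume L: ?L
    show ?R
    proof (intro ballI impI)
      fix e assume e: "e \<in> E" "\<omega> e = 1"
      then obtain i j where "e = {i, j}"
        using assms unfolding finite_graph_def by blast
      with L e show "monochromatic \<sigma> e"
        by (auto simp: monochromatic_def)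
    qed
  next
    assume ?R
    then show ?L by (auto simp: monochromatic_def)
  qed
  then show ?thesis by (simp add: es_indicator_def)
qed

text \<open>Writing both the percolation weight and, below, the compatibility indicator as a product over
  all edges is what makes the sum over \<open>\<omega>\<close> factorize.\<close>

lemma bernoulli_weight_eq_prod:
  assumes "finite E" "\<omega> \<in> edge_configs E"
  shows "bernoulli_weight p E \<omega> = (\<Prod>e\<in>E. if \<omega> e = 1 then p e else 1 - p e)"
proof -
  have "{e \<in> E. \<omega> e = 0} = {e \<in> E. \<omega> e \<noteq> 1}"
    using assms(2) by (auto simp: edge_configs_def)
  then show ?thesis
    using assms(1) by (simp add: bernoulli_weight_def prod.If_cases Int_def)
qed

lemma sum_edge_configs_es:
  assumes G: "finite_graph V E"
  shows "(\<Sum>\<omega>\<in>edge_configs E. bernoulli_weight p E \<omega> * es_indicator E \<sigma> \<omega>)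
         = (\<Prod>e\<in>E. if monochromatic \<sigma> e then 1 else 1 - p e)"
proof -
  have fin: "finite E" using G by (rule finite_edges)
  \<comment> \<open>The joint weight of edge \<open>e\<close> in state \<open>n\<close>: opening a non-monochromatic edge costs the factor 0.\<close>
  define f where "f e n = (if n = 1 then p e * of_bool (monochromatic \<sigma> e) else 1 - p e)"
    for e and n :: nat
  have "(\<Sum>\<omega>\<in>edge_configs E. bernoulli_weight p E \<omega> * es_indicator E \<sigma> \<omega>)
        = (\<Sum>\<omega>\<in>edge_configs E. \<Prod>e\<in>E. f e (\<omega> e))"
  proof (rule sum.cong[OF refl])
    fix \<omega> assume \<omega>: "\<omega> \<in> edge_configs E"
    have "es_indicator E \<sigma> \<omega> = (\<Prod>e\<in>E. of_bool (\<omega> e = 1 \<longrightarrow> monochromatic \<sigma> e))"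
      unfolding es_indicator_eq[OF G] using fin by (auto intro!: prod_zero)
    then show "bernoulli_weight p E \<omega> * es_indicator E \<sigma> \<omega> = (\<Prod>e\<in>E. f e (\<omega> e))"
      unfolding bernoulli_weight_eq_prod[OF fin \<omega>] f_def
      by (auto simp flip: prod.distrib intro!: prod.cong)
  qed
  also have "\<dots> = (\<Prod>e\<in>E. \<Sum>n\<in>{0, 1}. f e n)"
    unfolding edge_configs_def by (rule prod_sum_PiE[symmetric]) (use fin in auto)
  also have "\<dots> = (\<Prod>e\<in>E. if monochromatic \<sigma> e then 1 else 1 - p e)"
    by (rule prod.cong) (auto simp: f_def)
  finally show ?thesis .
qed

text \<open>The exponent \<open>b * (\<sigma> i * \<sigma> j - 1)\<close> on the right is \<open>0\<close> for equal and \<open>- 2 * b\<close> for opposite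
  spins at the endpoints \<open>i\<close>, \<open>j\<close> of \<open>e\<close>.\<close>

lemma edge_factor:
  assumes G: "finite_graph V E" and e: "e \<in> E" and \<sigma>: "\<sigma> \<in> spins V"
  shows "(if monochromatic \<sigma> e then 1 else exp (- 2 * b))
         = exp (- b) * exp (b * (\<Prod>i\<in>e. \<sigma> i))"
proof -
  obtain i j where ij: "i \<in> V" "j \<in> V" "i \<noteq> j" "e = {i, j}"
    using G e unfolding finite_graph_def by blast
  show ?thesis
  proof (cases "\<sigma> i = \<sigma> j")
    case True
    then have "(\<Prod>i\<in>e. \<sigma> i) = 1" "monochromatic \<sigma> e"
      using spin_cases[OF \<sigma> ij(2)] ij by (auto simp: monochromatic_def)
    then show ?thesis by (simp flip: exp_add)
  next
    case False
    then have "(\<Prod>i\<in>e. \<sigma> i) = - 1" "\<not> monochromatic \<sigma> e"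
      using spin_cases[OF \<sigma> ij(1)] spin_cases[OF \<sigma> ij(2)] ij
      by (auto simp: monochromatic_def)
    then show ?thesis by (simp flip: exp_add)
  qed
qed

lemma sum_es_weight_edge_configs:
  assumes G: "finite_graph V E" and \<sigma>: "\<sigma> \<in> spins V"
    and p: "\<And>e. e \<in> E \<Longrightarrow> p e = 1 - exp (- 2 * \<beta> * J e)"
  shows "(\<Sum>\<omega>\<in>edge_configs E. es_weight \<beta> p h V E (\<sigma>, \<omega>))
         = exp (- \<beta> * (\<Sum>e\<in>E. J e)) * ising_weight \<beta> J h V E \<sigma>"
proof -
  have fin: "finite E" using G by (rule finite_edges)
  have "(\<Prod>e\<in>E. if monochromatic \<sigma> e then 1 else 1 - p e)
        = (\<Prod>e\<in>E. exp (- (\<beta> * J e)) * exp (\<beta> * J e * (\<Prod>i\<in>e. \<sigma> i)))"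
  proof (rule prod.cong[OF refl])
    fix e assume e: "e \<in> E"
    show "(if monochromatic \<sigma> e then 1 else 1 - p e)
        = exp (- (\<beta> * J e)) * exp (\<beta> * J e * (\<Prod>i\<in>e. \<sigma> i))"
      using edge_factor[OF G e \<sigma>, of "\<beta> * J e"] by (simp add: p[OF e] mult.assoc split: if_splits)
  qed
  also have "\<dots> = exp (- \<beta> * (\<Sum>e\<in>E. J e)) * exp (\<beta> * (\<Sum>e\<in>E. J e * (\<Prod>i\<in>e. \<sigma> i)))"
    using fin by (simp add: prod.distrib exp_sum sum_distrib_left mult.assoc flip: sum_negf)
  finally have edges: "(\<Prod>e\<in>E. if monochromatic \<sigma> e then 1 else 1 - p e) = \<dots>" .
  have "(\<Sum>\<omega>\<in>edge_configs E. es_weight \<beta> p h V E (\<sigma>, \<omega>))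
      = (\<Sum>\<omega>\<in>edge_configs E. bernoulli_weight p E \<omega> * es_indicator E \<sigma> \<omega>)
        * exp (\<beta> * (\<Sum>i\<in>V. h i * \<sigma> i))"
    by (simp add: es_weight_def es_field[OF \<sigma>] sum_distrib_right)
  then show ?thesis
    by (simp add: sum_edge_configs_es[OF G] edges ising_weight_def exp_add)
qed

section \<open>The edge marginal\<close>

text \<open>A spin configuration on \<open>V\<close> that is constant on classes is the same thing as a spin
  configuration on the set \<open>V // R\<close> of classes. Along this bijection the exponent becomes a sum
  over classes, and since the spins of different classes are independent, the sum of products is
  a product of sums over a single sign.\<close>

lemma sum_spins_constant_on_classes:
  fixes g :: "'a \<Rightarrow> real"
  assumes fin: "finite V" and R: "equiv V R"
  shows "(\<Sum>\<sigma> | \<sigma> \<in> spins V \<and> (\<forall>(i, j)\<in>R. \<sigma> i = \<sigma> j). exp (\<Sum>i\<in>V. g i * \<sigma> i))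
         = (\<Prod>K\<in>V // R. 2 * cosh (\<Sum>i\<in>K. g i))"
proof -
  have cls: "R `` {i} \<in> V // R" if "i \<in> V" for i
    using that by (rule quotientI)
  have sub: "K \<subseteq> V" if "K \<in> V // R" for K
    using that R by (simp add: in_quotient_imp_subset)
  have finQ: "finite (V // R)"
    by (rule finite_subset[of _ "Pow V"]) (use sub fin in auto)
  have class_eq: "R `` {i} = K" if "K \<in> V // R" "i \<in> K" for K i
    using that R by (metis Image_singleton_iff equiv_class_eq_iff quotientE)
  have rep: "(SOME i. i \<in> K) \<in> K" if "K \<in> V // R" for K
    using in_quotient_imp_non_empty[OF R that] by (simp add: some_in_eq)
  let ?S = "{\<sigma> \<in> spins V. \<forall>(i, j)\<in>R. \<sigma> i = \<sigma> j}"
  \<comment> \<open>The mutually inverse maps: \<open>ext\<close> spreads the spin of a class to its members, and \<open>res\<close> reads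
      off the spin of a class at a chosen representative.\<close>
  define ext where "ext s = (\<lambda>i\<in>V. s (R `` {i}) :: real)" for s
  define res where "res \<sigma> = (\<lambda>K\<in>V // R. \<sigma> (SOME i. i \<in> K) :: real)" for \<sigma>
  have field: "(\<Sum>i\<in>V. g i * ext s i) = (\<Sum>K\<in>V // R. (\<Sum>i\<in>K. g i) * s K)" for s
  proof -
    have "(\<Sum>i\<in>V. g i * ext s i) = (\<Sum>i\<in>\<Union>(V // R). g i * ext s i)"
      by (simp add: Union_quotient[OF R])
    also have "\<dots> = (\<Sum>K\<in>V // R. \<Sum>i\<in>K. g i * ext s i)"
      using sub fin quotient_disj[OF R]
      by (subst sum.Union_disjoint) (blast intro: finite_subset | simp)+
    also have "\<dots> = (\<Sum>K\<in>V // R. (\<Sum>i\<in>K. g i) * s K)"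
      unfolding sum_distrib_right
      by (intro sum.cong refl) (use sub class_eq in \<open>auto simp: ext_def\<close>)
    finally show ?thesis .
  qed
  have "(\<Sum>\<sigma>\<in>?S. exp (\<Sum>i\<in>V. g i * \<sigma> i))
      = (\<Sum>s\<in>spins (V // R). exp (\<Sum>K\<in>V // R. (\<Sum>i\<in>K. g i) * s K))"
  proof (rule sum.reindex_bij_witness[where i = ext and j = res])
    fix \<sigma> assume \<sigma>: "\<sigma> \<in> ?S"
    show "ext (res \<sigma>) = \<sigma>"
    proof
      fix i
      show "ext (res \<sigma>) i = \<sigma> i"
      proof (cases "i \<in> V")
        case True
        then have "(i, SOME j. j \<in> R `` {i}) \<in> R"
          using rep[OF cls] by simp
        then show ?thesis
          using True \<sigma> cls by (auto simp: ext_def res_def)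
      next
        case False
        then show ?thesis
          using \<sigma> by (auto simp: ext_def spins_def PiE_def extensional_def)
      qed
    qed
    then show "exp (\<Sum>K\<in>V // R. (\<Sum>i\<in>K. g i) * res \<sigma> K) = exp (\<Sum>i\<in>V. g i * \<sigma> i)"
      by (simp flip: field)
    have "\<sigma> i \<in> {-1, 1}" if "i \<in> V" for i
      using \<sigma> that by (auto simp: spins_def)
    then show "res \<sigma> \<in> spins (V // R)"
      unfolding res_def spins_def using rep sub by (intro PiE_I) auto
  next
    fix s assume s: "s \<in> spins (V // R)"
    show "res (ext s) = s"
    proof
      fix K
      show "res (ext s) K = s K"
      proof (cases "K \<in> V // R")
        case True
        then show ?thesis
          using rep[OF True] sub[OF True] class_eq[OF True] by (auto simp: ext_def res_def)
      next
        case False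
        then show ?thesis
          using s by (auto simp: res_def spins_def PiE_def extensional_def)
      qed
    qed
    have "ext s \<in> spins V"
      using s cls by (auto simp: ext_def spins_def)
    moreover have "ext s i = ext s j" if "(i, j) \<in> R" for i j
      using that R by (auto simp: ext_def equiv_class_eq_iff)
    ultimately show "ext s \<in> ?S" by auto
  qed
  also have "\<dots> = (\<Sum>s\<in>V // R \<rightarrow>\<^sub>E {-1, 1}. \<Prod>K\<in>V // R. exp ((\<Sum>i\<in>K. g i) * s K))"
    using finQ by (simp add: spins_def exp_sum)
  also have "\<dots> = (\<Prod>K\<in>V // R. \<Sum>t\<in>{-1, 1}. exp ((\<Sum>i\<in>K. g i) * t))"
    by (rule prod_sum_PiE[symmetric]) (use finQ in auto)
  also have "\<dots> = (\<Prod>K\<in>V // R. 2 * cosh (\<Sum>i\<in>K. g i))"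
    by (rule prod.cong) (auto simp: cosh_field_def)
  finally show ?thesis .
qed

text \<open>The relation whose classes are the clusters.\<close>

definition connectivity :: "'a set \<Rightarrow> 'a set set \<Rightarrow> ('a \<times> 'a) set" where
  "connectivity V F = {(i, j). i \<in> V \<and> j \<in> V \<and> (i, j) \<in> {(u, v). {u, v} \<in> F}\<^sup>*}"

lemma equiv_connectivity: "equiv V (connectivity V F)"
proof -
  have "sym ({(u, v). {u, v} \<in> F}\<^sup>*)"
    by (intro sym_rtrancl symI) (simp add: insert_commute)
  then show ?thesis
    by (intro equivI) (auto simp: connectivity_def refl_on_def intro!: symI transI
        dest: symD intro: rtrancl_trans)
qed

text \<open>Agreement across each edge propagates along paths, so compatibility with the open edges
  amounts to being constant on clusters.\<close>

lemma constant_on_connectivity_iff: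
  assumes G: "finite_graph V E" and F: "F \<subseteq> E"
  shows "(\<forall>(i, j)\<in>connectivity V F. \<sigma> i = \<sigma> j) \<longleftrightarrow> (\<forall>e\<in>F. monochromatic \<sigma> e)"
proof
  assume L: "\<forall>(i, j)\<in>connectivity V F. \<sigma> i = \<sigma> j"
  show "\<forall>e\<in>F. monochromatic \<sigma> e"
  proof
    fix e assume e: "e \<in> F"
    then obtain i j where ij: "i \<in> V" "j \<in> V" "e = {i, j}"
      using G F unfolding finite_graph_def by blast
    then have "(i, j) \<in> connectivity V F"
      using e by (auto simp: connectivity_def)
    with L ij show "monochromatic \<sigma> e"
      by (auto simp: monochromatic_def)
  qed
next
  assume R: "\<forall>e\<in>F. monochromatic \<sigma> e"
  have "\<sigma> i = \<sigma> j" if "(i, j) \<in> {(u, v). {u, v} \<in> F}\<^sup>*" for i j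
    using that by (induction rule: rtrancl_induct) (use R in \<open>auto simp: monochromatic_def\<close>)
  then show "\<forall>(i, j)\<in>connectivity V F. \<sigma> i = \<sigma> j"
    by (auto simp: connectivity_def)
qed

text \<open>The percolation weight is a common factor; what remains is the field weight summed over the
  configurations constant on clusters, with local field \<open>\<beta> * h i\<close> at vertex \<open>i\<close>.\<close>

lemma sum_es_weight_spins:
  assumes G: "finite_graph V E"
  shows "(\<Sum>\<sigma>\<in>spins V. es_weight \<beta> p h V E (\<sigma>, \<omega>)) = rc_weight \<beta> p h V E \<omega>"
proof -
  let ?R = "connectivity V (open_edges E \<omega>)"
  let ?w = "\<lambda>\<sigma>. exp (\<Sum>i\<in>V. \<beta> * h i * \<sigma> i)"
  have w: "?w \<sigma> = exp (\<beta> * (\<Sum>i\<in>V. h i * \<sigma> i))" for \<sigma>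
    by (simp add: sum_distrib_left mult.assoc)
  have fin: "finite V" using G by (simp add: finite_graph_def)
  have ind: "es_indicator E \<sigma> \<omega> = of_bool (\<forall>(i, j)\<in>?R. \<sigma> i = \<sigma> j)" for \<sigma>
  proof -
    have "(\<forall>(i, j)\<in>?R. \<sigma> i = \<sigma> j) \<longleftrightarrow> (\<forall>e\<in>open_edges E \<omega>. monochromatic \<sigma> e)"
      by (rule constant_on_connectivity_iff[OF G]) (auto simp: open_edges_def)
    then show ?thesis
      by (auto simp: es_indicator_eq[OF G] open_edges_def)
  qed
  have "(\<Sum>\<sigma>\<in>spins V. es_weight \<beta> p h V E (\<sigma>, \<omega>))
      = bernoulli_weight p E \<omega> * (\<Sum>\<sigma>\<in>spins V. if \<forall>(i, j)\<in>?R. \<sigma> i = \<sigma> j then ?w \<sigma> else 0)"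
    unfolding w sum_distrib_left[of "bernoulli_weight p E \<omega>"]
    by (rule sum.cong) (simp_all add: es_weight_def es_field ind)
  also have "(\<Sum>\<sigma>\<in>spins V. if \<forall>(i, j)\<in>?R. \<sigma> i = \<sigma> j then ?w \<sigma> else 0)
      = (\<Sum>\<sigma> | \<sigma> \<in> spins V \<and> (\<forall>(i, j)\<in>?R. \<sigma> i = \<sigma> j). ?w \<sigma>)"
    by (rule sum.inter_filter[symmetric]) (rule finite_spins[OF G])
  also have "\<dots> = (\<Prod>K\<in>V // ?R. 2 * cosh (\<Sum>i\<in>K. \<beta> * h i))"
    by (rule sum_spins_constant_on_classes[OF fin equiv_connectivity])
  finally show ?thesis
    by (simp add: rc_weight_def clusters_def connectivity_def sum_distrib_left)
qed

section \<open>The Edwards--Sokal coupling\<close>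

theorem theorem1:
  fixes V :: "'a set" and E :: "'a set set"
    and \<beta> :: real and J p :: "'a set \<Rightarrow> real" and h :: "'a \<Rightarrow> real"
  assumes "finite_graph V E"
    and "\<beta> > 0"
    and "\<And>e. e \<in> E \<Longrightarrow> J e \<ge> 0"
    and "\<And>e. e \<in> E \<Longrightarrow> p e = 1 - exp (- 2 * \<beta> * J e)"
  shows "(\<forall>\<sigma>\<in>spins V.
            (\<Sum>\<omega>\<in>edge_configs E. edwards_sokal \<beta> p h V E (\<sigma>, \<omega>)) = ising \<beta> J h V E \<sigma>) \<and>
         (\<forall>\<omega>\<in>edge_configs E.
            (\<Sum>\<sigma>\<in>spins V. edwards_sokal \<beta> p h V E (\<sigma>, \<omega>)) = random_cluster \<beta> p h V E \<omega>)"
proof (intro conjI ballI)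
  fix \<sigma> assume "\<sigma> \<in> spins V"
  then show "(\<Sum>\<omega>\<in>edge_configs E. edwards_sokal \<beta> p h V E (\<sigma>, \<omega>)) = ising \<beta> J h V E \<sigma>"
    unfolding edwards_sokal_def ising_def
    by (rule sum_normalized_snd[rotated])
       (rule sum_es_weight_edge_configs[OF assms(1) _ assms(4)], simp_all)
next
  fix \<omega> assume \<omega>: "\<omega> \<in> edge_configs E"
  show "(\<Sum>\<sigma>\<in>spins V. edwards_sokal \<beta> p h V E (\<sigma>, \<omega>)) = random_cluster \<beta> p h V E \<omega>"
    unfolding edwards_sokal_def random_cluster_def normalized_swap[of "spins V"]
    by (rule sum_normalized_snd[where c = 1]) (simp_all add: \<omega> sum_es_weight_spins[OF assms(1)])
qed

end
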